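(* Let $\mathbb{K}$ be an algebraically closed field, let $a_1\ge a_2\ge\dots\ge a_m$ and $d_1\ge d_2\ge\dots\ge d_n$ be positive integers, and consider the preprojective Kronecker representations $M^P=\bigoplus_{i=1}^{m}Q_{a_i}$ and $N^P=\bigoplus_{j=1}^{n}Q_{d_j}$ over $\mathbb{K}$. Let $r_1,s_1,r_2,s_2,\dots,r_t=n$ be the integers attached to the sequences $(a_i)$ and $(d_j)$. Then $N^P$ is a subrepresentation of $M^P$ if and only if $r_1=0$ and, for all $1\le i\le t-1$, $$\sum_{j=1}^{s_i}a_j\ \ge\sum_{j=r_1+1}^{r_{i+1}}d_j\qquad\text{and}\qquad\sum_{j=1}^{s_i}(a_j-1)\ \ge\sum_{j=r_1+1}^{r_{i+1}}(d_j-1).$$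
   Context: Representations. A Kronecker representation $(V,W;f,g)$ consists of finite-dimensional $\mathbb{K}$-vector spaces $V,W$ and linear maps $f,g:V\to W$. For $i\ge1$, $Q_i=\left(\mathbb{K}^{i-1},\mathbb{K}^{i};\left[\begin{array}{c} I \\ 0 \end{array}\right],\left[\begin{array}{c} 0 \\ I \end{array}\right]\right)$, with $I$ the identity matrix of size $i-1$. Direct sums are taken componentwise. Subrepresentations are considered up to isomorphism: $(V',W';f',g')$ is a subrepresentation of $(V,W;f,g)$ if there are injective linear maps $\phi:V'\to V$ and $\psi:W'\to W$ with $f\phi=\psi f'$ and $g\phi=\psi g'$. Integers $r_l,s_l$. Put $s_0=0$ and $a_{m+1}=0$, and let the maximum of an empty set be $0$. For $l=1,2,\dots$ define $$r_l:=\max\{1\le j\le n\mid d_j>a_{s_{l-1}+1}\},$$ and, if $r_l<n$, $$s_l:=\max\{1\le i\le m\mid d_{r_l+1}\le a_i\}.$$ The process stops at the first index $t$ with $r_t=n$. Empty sums are $0$. *)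

theory Defs
  imports
    "HOL-Computational_Algebra.Polynomial"
    "Jordan_Normal_Form.Matrix"
begin

section \<open>Kronecker representations\<close>

text \<open>
  Finite-dimensional spaces are taken in coordinates: a representation is
  \<open>(K^v, K^w; f, g)\<close>, with the linear maps \<open>f, g\<close> given by their \<open>w \<times> v\<close> matrices (acting on
  column vectors). Matrices with no rows or no columns are allowed and keep their dimensions.
\<close>

record 'a kronecker_rep =
  dimV :: nat
  dimW :: nat
  mapf :: "'a mat"
  mapg :: "'a mat"

definition is_kronecker_rep :: "'a kronecker_rep \<Rightarrow> bool" where
  "is_kronecker_rep R \<longleftrightarrow>
     mapf R \<in> carrier_mat (dimW R) (dimV R) \<and> mapg R \<in> carrier_mat (dimW R) (dimV R)"

definition Q :: "nat \<Rightarrow> 'a::field kronecker_rep" where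
  "Q i = \<lparr> dimV = i - 1, dimW = i,
           mapf = 1\<^sub>m (i - 1) @\<^sub>r 0\<^sub>m 1 (i - 1),
           mapg = 0\<^sub>m 1 (i - 1) @\<^sub>r 1\<^sub>m (i - 1) \<rparr>"

text \<open>
  Under \<open>K^(v1) \<oplus> \<dots> \<oplus> K^(vk) = K^(v1 + \<dots> + vk)\<close> the componentwise direct sum of linear maps has
  the block-diagonal matrix.
\<close>

definition direct_sum_rep :: "'a::field kronecker_rep list \<Rightarrow> 'a kronecker_rep" where
  "direct_sum_rep Rs = \<lparr> dimV = sum_list (map dimV Rs), dimW = sum_list (map dimW Rs),
                         mapf = diag_block_mat (map mapf Rs),
                         mapg = diag_block_mat (map mapg Rs) \<rparr>"

definition subrep :: "'a::field kronecker_rep \<Rightarrow> 'a kronecker_rep \<Rightarrow> bool" where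
  "subrep R' R \<longleftrightarrow>
     is_kronecker_rep R' \<and> is_kronecker_rep R \<and>
     (\<exists>\<phi> \<in> carrier_mat (dimV R) (dimV R'). \<exists>\<psi> \<in> carrier_mat (dimW R) (dimW R').
        inj_on (\<lambda>x. \<phi> *\<^sub>v x) (carrier_vec (dimV R')) \<and>
        inj_on (\<lambda>x. \<psi> *\<^sub>v x) (carrier_vec (dimW R')) \<and>
        mapf R * \<phi> = \<psi> * mapf R' \<and>
        mapg R * \<phi> = \<psi> * mapg R')"

definition preprojective :: "nat \<Rightarrow> (nat \<Rightarrow> nat) \<Rightarrow> 'a::field kronecker_rep" where
  "preprojective m a = direct_sum_rep (map (\<lambda>i. Q (a i)) [1..<m+1])"

lemma is_kronecker_rep_Q: "1 \<le> i \<Longrightarrow> is_kronecker_rep (Q i :: 'a::field kronecker_rep)"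
proof -
  assume i: "1 \<le> i"
  have "1\<^sub>m (i - 1) @\<^sub>r 0\<^sub>m 1 (i - 1) \<in> carrier_mat (i - 1 + 1) (i - 1)"
    by (rule carrier_append_rows) (rule one_carrier_mat zero_carrier_mat)+
  moreover have "0\<^sub>m 1 (i - 1) @\<^sub>r 1\<^sub>m (i - 1) \<in> carrier_mat (1 + (i - 1)) (i - 1)"
    by (rule carrier_append_rows) (rule one_carrier_mat zero_carrier_mat)+
  ultimately show ?thesis
    unfolding is_kronecker_rep_def Q_def kronecker_rep.simps
    by (simp only: le_add_diff_inverse[OF i] le_add_diff_inverse2[OF i])
qed

lemma is_kronecker_rep_direct_sum:
  fixes Rs :: "'a::field kronecker_rep list"
  assumes "\<And>R. R \<in> set Rs \<Longrightarrow> is_kronecker_rep R"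
  shows "is_kronecker_rep (direct_sum_rep Rs)"
proof -
  have "map dim_row (map mapf Rs) = map dimW Rs" "map dim_col (map mapf Rs) = map dimV Rs"
    "map dim_row (map mapg Rs) = map dimW Rs" "map dim_col (map mapg Rs) = map dimV Rs"
    using assms unfolding is_kronecker_rep_def map_map
    by (auto intro!: map_cong)
  note dims = this
  show ?thesis
    unfolding is_kronecker_rep_def direct_sum_rep_def kronecker_rep.simps
    by (intro conjI carrier_matI) (simp_all only: dim_diag_block_mat dims)
qed

lemma is_kronecker_rep_preprojective:
  assumes "\<And>i. 1 \<le> i \<Longrightarrow> i \<le> m \<Longrightarrow> 1 \<le> a i"
  shows "is_kronecker_rep (preprojective m a :: 'a::field kronecker_rep)"
  unfolding preprojective_def
proof (rule is_kronecker_rep_direct_sum)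
  fix R :: "'a kronecker_rep"
  assume "R \<in> set (map (\<lambda>i. Q (a i)) [1..<m+1])"
  then obtain i where "1 \<le> i" "i \<le> m" "R = Q (a i)"
    by fastforce
  then show "is_kronecker_rep R"
    using is_kronecker_rep_Q assms by blast
qed


section \<open>The integers attached to a pair of sequences\<close>

text \<open>
  The sequences are \<open>a 1, \<dots>, a m\<close> and \<open>d 1, \<dots>, d n\<close>; values of \<open>a\<close> and \<open>d\<close> outside these ranges
  are never used.
\<close>

definition max0 :: "nat set \<Rightarrow> nat" where
  "max0 A = (if A = {} then 0 else Max A)"

text \<open>The convention that the entry of index \<open>m + 1\<close> is \<open>0\<close>.\<close>

definition ext0 :: "nat \<Rightarrow> (nat \<Rightarrow> nat) \<Rightarrow> nat \<Rightarrow> nat" where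
  "ext0 m a i = (if i \<le> m then a i else 0)"

text \<open>
  \<open>r_next\<close> computes \<open>r_l\<close> from \<open>s_(l-1)\<close>, and \<open>s_next\<close> computes \<open>s_l\<close> from \<open>r_l\<close> when \<open>r_l < n\<close>.
  The value \<open>0\<close> for \<open>r_l = n\<close> is a dummy: the process has then stopped. Likewise \<open>r_num\<close> is
  meaningful only for \<open>l \<ge> 1\<close>.
\<close>

definition r_next :: "nat \<Rightarrow> nat \<Rightarrow> (nat \<Rightarrow> nat) \<Rightarrow> (nat \<Rightarrow> nat) \<Rightarrow> nat \<Rightarrow> nat" where
  "r_next m n a d s = max0 {j. 1 \<le> j \<and> j \<le> n \<and> d j > ext0 m a (s + 1)}"

definition s_next :: "nat \<Rightarrow> nat \<Rightarrow> (nat \<Rightarrow> nat) \<Rightarrow> (nat \<Rightarrow> nat) \<Rightarrow> nat \<Rightarrow> nat" where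
  "s_next m n a d r = (if r < n then max0 {i. 1 \<le> i \<and> i \<le> m \<and> d (r + 1) \<le> a i} else 0)"

primrec s_num :: "nat \<Rightarrow> nat \<Rightarrow> (nat \<Rightarrow> nat) \<Rightarrow> (nat \<Rightarrow> nat) \<Rightarrow> nat \<Rightarrow> nat" where
  "s_num m n a d 0 = 0"
| "s_num m n a d (Suc l) = s_next m n a d (r_next m n a d (s_num m n a d l))"

definition r_num :: "nat \<Rightarrow> nat \<Rightarrow> (nat \<Rightarrow> nat) \<Rightarrow> (nat \<Rightarrow> nat) \<Rightarrow> nat \<Rightarrow> nat" where
  "r_num m n a d l = r_next m n a d (s_num m n a d (l - 1))"

definition t_num :: "nat \<Rightarrow> nat \<Rightarrow> (nat \<Rightarrow> nat) \<Rightarrow> (nat \<Rightarrow> nat) \<Rightarrow> nat" where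
  "t_num m n a d = (LEAST l. 1 \<le> l \<and> r_num m n a d l = n)"

text \<open>The process does stop, so that \<^const>\<open>t_num\<close> is well defined.\<close>

lemma max0_ge: "finite A \<Longrightarrow> x \<in> A \<Longrightarrow> x \<le> max0 A"
  by (auto simp: max0_def)

lemma max0_le: "finite A \<Longrightarrow> (\<And>x. x \<in> A \<Longrightarrow> x \<le> b) \<Longrightarrow> max0 A \<le> b"
  by (auto simp: max0_def)

lemma s_num_grows:
  assumes d: "\<And>i. 1 \<le> i \<Longrightarrow> i \<le> n \<Longrightarrow> 1 \<le> d i"
    and go: "\<And>k. 1 \<le> k \<Longrightarrow> k \<le> l \<Longrightarrow> r_num m n a d k \<noteq> n"
  shows "l \<le> s_num m n a d l \<and> s_num m n a d l \<le> m"
  using go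
proof (induction l)
  case 0
  then show ?case by simp
next
  case (Suc l)
  define s where "s = s_num m n a d l"
  define r where "r = r_next m n a d s"
  have s: "l \<le> s" "s \<le> m"
    using Suc.IH Suc.prems unfolding s_def by simp_all
  have "r \<noteq> n" using Suc.prems[of "Suc l"] by (simp add: r_num_def r_def s_def)
  moreover have "r \<le> n" unfolding r_def r_next_def by (rule max0_le) auto
  ultimately have r: "r < n" by simp
  have "\<not> d (r + 1) > ext0 m a (s + 1)"
  proof
    assume "d (r + 1) > ext0 m a (s + 1)"
    then have "r + 1 \<le> r"
      using r unfolding r_def r_next_def by (intro max0_ge) auto
    then show False by simp
  qed
  then have le: "s + 1 \<le> m \<and> d (r + 1) \<le> a (s + 1)"
    using d[of "r + 1"] r by (auto simp: ext0_def split: if_splits)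
  have "s + 1 \<le> max0 {i. 1 \<le> i \<and> i \<le> m \<and> d (r + 1) \<le> a i}"
    using le by (intro max0_ge) auto
  moreover have "max0 {i. 1 \<le> i \<and> i \<le> m \<and> d (r + 1) \<le> a i} \<le> m"
    by (rule max0_le) auto
  moreover have "s_num m n a d (Suc l) = max0 {i. 1 \<le> i \<and> i \<le> m \<and> d (r + 1) \<le> a i}"
    using r by (simp add: s_next_def r_def s_def)
  ultimately show ?case using s by simp
qed

lemma t_num_stops:
  assumes "\<And>i. 1 \<le> i \<Longrightarrow> i \<le> n \<Longrightarrow> 1 \<le> d i"
  shows "1 \<le> t_num m n a d \<and> r_num m n a d (t_num m n a d) = n"
proof -
  have "\<exists>l. 1 \<le> l \<and> r_num m n a d l = n"
  proof (rule ccontr)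
    assume "\<not> ?thesis"
    then have "Suc m \<le> s_num m n a d (Suc m) \<and> s_num m n a d (Suc m) \<le> m"
      using assms by (intro s_num_grows) auto
    then show False by linarith
  qed
  then show ?thesis unfolding t_num_def by (rule LeastI_ex)
qed

end

theory Submission
  imports Defs "Jordan_Normal_Form.Determinant"
begin

text \<open>
  A morphism from \<open>Q d\<close> to \<open>Q a\<close> is multiplication by a polynomial of degree at most \<open>a - d\<close>. A
  morphism from \<open>N = Q (d 1) \<oplus> \<dots> \<oplus> Q (d n)\<close> to \<open>M = Q (a 1) \<oplus> \<dots> \<oplus> Q (a m)\<close> is therefore a matrix of
  such polynomials, and it is an embedding exactly if it is injective on the \<open>W\<close>-spaces
  (\<open>subrep_iff_equivariant\<close>, \<open>shift_form_preprojective\<close>).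

  Necessity. There is no nonzero morphism from \<open>Q d\<close> to \<open>Q a\<close> if \<open>d > a\<close>. So if \<open>d r > a (s + 1)\<close>, then
  an embedding maps the first \<open>r\<close> summands of \<open>N\<close> into the first \<open>s\<close> summands of \<open>M\<close>, and comparing the
  dimensions of \<open>W\<close> gives \<open>d 1 + \<dots> + d r \<le> a 1 + \<dots> + a s\<close> (\<open>embedding_offset_le\<close>). The process picks
  pairs \<open>(r, s)\<close> of this kind. With \<open>s = 0\<close> the inequality is impossible, whence \<open>r 1 = 0\<close>, and the
  inequalities for the dimensions of \<open>V\<close> follow from those for \<open>W\<close> by arithmetic
  (\<open>offset_minus_1_le\<close>).

  Sufficiency. Cut a line into consecutive intervals of lengths \<open>a 1, a 2, \<dots>\<close>, and the same line
  into consecutive intervals of lengths \<open>d 1, d 2, \<dots>\<close>. The inequalities for \<open>W\<close> say that the interval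
  of \<open>d j\<close> ends within the intervals of those \<open>a i\<close> that are at least \<open>d j\<close>
  (\<open>partial_sums_cover\<close>). So whenever two intervals overlap, there is a monomial that maps \<open>Q (d j)\<close> to
  \<open>Q (a i)\<close>; its exponent is the relative position of the two intervals, corrected when the interval
  of \<open>d j\<close> crosses a boundary so that the image stays in \<open>Q (a i)\<close>. An interval that crosses a
  boundary is thus mapped to both neighbours. The resulting 0-1 matrix is injective because its
  kernel equations can be solved in two triangular passes, one from left to right and one from right
  to left (\<open>inj_coeffs_target\<close>).
\<close>


section \<open>Morphisms in coordinates\<close>

text \<open>
  The map of coordinate spaces that sends the basis vector \<open>e x\<close> to \<open>e (\<sigma> x)\<close>. Both structure maps
  of a direct sum of representations \<open>Q i\<close> are of this kind.
\<close>

definition selection_mat :: "nat \<Rightarrow> nat \<Rightarrow> (nat \<Rightarrow> nat) \<Rightarrow> 'k::field mat" where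
  "selection_mat w v \<sigma> = mat w v (\<lambda>(p, x). if p = \<sigma> x then 1 else 0)"

lemma selection_mat_carrier [simp]: "selection_mat w v \<sigma> \<in> carrier_mat w v"
  by (simp add: selection_mat_def)

lemma mult_selection_mat:
  assumes "\<psi> \<in> carrier_mat n w" "q < n" "x < v" "\<sigma> x < w"
  shows "(\<psi> * selection_mat w v \<sigma>) $$ (q, x) = \<psi> $$ (q, \<sigma> x)"
proof -
  have "(\<psi> * selection_mat w v \<sigma>) $$ (q, x) = (\<Sum>p = 0..<w. \<psi> $$ (q, p) * (if p = \<sigma> x then 1 else 0))"
    using assms by (simp add: selection_mat_def scalar_prod_def)
  also have "\<dots> = (\<Sum>p = 0..<w. if p = \<sigma> x then \<psi> $$ (q, p) else 0)"
    by (rule sum.cong) auto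
  finally show ?thesis using assms(4) by simp
qed

lemma selection_mat_mult:
  assumes \<phi>: "\<phi> \<in> carrier_mat v n" and "q < w" "y < n"
  shows "(selection_mat w v \<sigma> * \<phi>) $$ (q, y) = (\<Sum>x<v. if q = \<sigma> x then \<phi> $$ (x, y) else 0)"
  using assms
  by (auto simp: selection_mat_def scalar_prod_def lessThan_atLeast0 intro!: sum.cong)

lemma selection_mat_mult_hit:
  assumes "\<phi> \<in> carrier_mat v n" "\<sigma> x < w" "y < n" "x < v" "inj_on \<sigma> {..<v}"
  shows "(selection_mat w v \<sigma> * \<phi>) $$ (\<sigma> x, y) = \<phi> $$ (x, y)"
proof -
  have "(\<Sum>x'<v. if \<sigma> x = \<sigma> x' then \<phi> $$ (x', y) else 0) = (\<Sum>x'<v. if x = x' then \<phi> $$ (x', y) else 0)"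
    using assms by (intro sum.cong) (auto simp: inj_on_def)
  then show ?thesis using assms by (simp add: selection_mat_mult)
qed

lemma selection_mat_mult_miss:
  assumes "\<phi> \<in> carrier_mat v n" "q < w" "y < n" "q \<notin> \<sigma> ` {..<v}"
  shows "(selection_mat w v \<sigma> * \<phi>) $$ (q, y) = 0"
  using assms by (subst selection_mat_mult) (auto intro!: sum.neutral)

text \<open>
  The basis of \<open>W\<close> is a line of \<open>w\<close> positions, and the basis of \<open>V\<close> is identified by \<open>\<tau>\<close> with the set
  \<open>S\<close> of those positions whose successor belongs to the same summand. Then \<open>f\<close> is the inclusion and
  \<open>g\<close> moves every position one step forward. If \<open>Q i\<close> is read as polynomials of degree below \<open>i - 1\<close>
  and below \<open>i\<close>, then \<open>f\<close> is the inclusion and \<open>g\<close> is multiplication by the variable.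
\<close>

definition shift_form :: "'k::field kronecker_rep \<Rightarrow> nat \<Rightarrow> nat set \<Rightarrow> bool" where
  "shift_form R w S \<longleftrightarrow> dimW R = w \<and> S \<subseteq> {p. Suc p < w} \<and>
     (\<exists>\<tau>. bij_betw \<tau> {..<dimV R} S \<and>
        mapf R = selection_mat w (dimV R) \<tau> \<and>
        mapg R = selection_mat w (dimV R) (\<lambda>x. Suc (\<tau> x)))"

text \<open>
  The conditions on the matrix \<open>\<Psi>\<close> of a map of the \<open>W\<close>-spaces under which it is the \<open>W\<close>-component
  of a morphism. Inside a pair of summands they say that \<open>\<Psi>\<close> is constant along diagonals, and that a
  diagonal that leaves the block through its last row or enters it through its first row is zero
  unless this happens in the last, respectively first, column. In terms of polynomials, a block is
  multiplication by a fixed polynomial.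
\<close>

definition equivariant :: "nat \<Rightarrow> nat set \<Rightarrow> nat set \<Rightarrow> (nat \<Rightarrow> nat \<Rightarrow> 'k::field) \<Rightarrow> bool" where
  "equivariant w S S' \<Psi> \<longleftrightarrow> (\<forall>p\<in>S'. \<forall>q<w.
     (q \<in> S \<longrightarrow> \<Psi> (Suc q) (Suc p) = \<Psi> q p) \<and>
     (q \<notin> S \<longrightarrow> \<Psi> q p = 0) \<and>
     (q \<notin> Suc ` S \<longrightarrow> \<Psi> q (Suc p) = 0))"

definition inj_coeffs :: "nat \<Rightarrow> nat \<Rightarrow> (nat \<Rightarrow> nat \<Rightarrow> 'k::field) \<Rightarrow> bool" where
  "inj_coeffs w w' \<Psi> \<longleftrightarrow>
     (\<forall>c. (\<forall>q<w. (\<Sum>p<w'. \<Psi> q p * c p) = 0) \<longrightarrow> (\<forall>p<w'. c p = 0))"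

lemma mult_mat_vec_coeff:
  assumes "\<psi> \<in> carrier_mat w w'" "x \<in> carrier_vec w'" "q < w"
  shows "(\<psi> *\<^sub>v x) $ q = (\<Sum>p<w'. \<psi> $$ (q, p) * x $ p)"
  using assms by (auto simp: scalar_prod_def lessThan_atLeast0 intro!: sum.cong)

lemma inj_on_mult_mat_vec_iff:
  fixes \<psi> :: "'k::field mat"
  assumes \<psi>: "\<psi> \<in> carrier_mat w w'"
  shows "inj_on (\<lambda>x. \<psi> *\<^sub>v x) (carrier_vec w') \<longleftrightarrow> inj_coeffs w w' (\<lambda>q p. \<psi> $$ (q, p))"
proof
  assume inj: "inj_on (\<lambda>x. \<psi> *\<^sub>v x) (carrier_vec w')"
  show "inj_coeffs w w' (\<lambda>q p. \<psi> $$ (q, p))"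
    unfolding inj_coeffs_def
  proof (intro allI impI)
    fix c :: "nat \<Rightarrow> 'k" and p
    assume c: "\<forall>q<w. (\<Sum>p<w'. \<psi> $$ (q, p) * c p) = 0" and p: "p < w'"
    have "\<psi> *\<^sub>v vec w' c = \<psi> *\<^sub>v 0\<^sub>v w'"
    proof (rule eq_vecI)
      fix q assume "q < dim_vec (\<psi> *\<^sub>v 0\<^sub>v w')"
      then have q: "q < w" using \<psi> by simp
      have "(\<psi> *\<^sub>v vec w' c) $ q = (\<Sum>p<w'. \<psi> $$ (q, p) * c p)"
        by (subst mult_mat_vec_coeff[OF \<psi> _ q]) auto
      moreover have "(\<psi> *\<^sub>v 0\<^sub>v w') $ q = 0"
        by (subst mult_mat_vec_coeff[OF \<psi> _ q]) auto
      ultimately show "(\<psi> *\<^sub>v vec w' c) $ q = (\<psi> *\<^sub>v 0\<^sub>v w') $ q" using c q by simp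
    qed (use \<psi> in simp)
    with inj have "vec w' c = 0\<^sub>v w'" by (auto dest: inj_onD)
    then have "vec w' c $ p = 0\<^sub>v w' $ p" by simp
    then show "c p = 0" using p by simp
  qed
next
  assume inj: "inj_coeffs w w' (\<lambda>q p. \<psi> $$ (q, p))"
  show "inj_on (\<lambda>x. \<psi> *\<^sub>v x) (carrier_vec w')"
  proof (rule inj_onI)
    fix x y :: "'k vec"
    assume x: "x \<in> carrier_vec w'" and y: "y \<in> carrier_vec w'" and eq: "\<psi> *\<^sub>v x = \<psi> *\<^sub>v y"
    have "\<forall>q<w. (\<Sum>p<w'. \<psi> $$ (q, p) * (x $ p - y $ p)) = 0"
    proof (intro allI impI)
      fix q assume q: "q < w"
      have "(\<psi> *\<^sub>v x) $ q = (\<psi> *\<^sub>v y) $ q" using eq by simp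
      then show "(\<Sum>p<w'. \<psi> $$ (q, p) * (x $ p - y $ p)) = 0"
        unfolding mult_mat_vec_coeff[OF \<psi> x q] mult_mat_vec_coeff[OF \<psi> y q]
        by (simp add: right_diff_distrib sum_subtractf)
    qed
    from inj[unfolded inj_coeffs_def, rule_format, OF this[rule_format]]
    show "x = y" using x y by (intro eq_vecI) auto
  qed
qed

text \<open>
  Since the map \<open>f\<close> of either representation is injective, a morphism is determined by its
  \<open>W\<close>-component \<open>\<psi>\<close>: the \<open>V\<close>-component is the restriction of \<open>\<psi>\<close> to the positions in \<open>S'\<close>, and it
  inherits the injectivity of \<open>\<psi>\<close>. So only
  \<open>\<psi>\<close> has to be found, and the two intertwining equations become the condition \<^const>\<open>equivariant\<close>.
\<close>

lemma subrep_iff_equivariant: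
  fixes M N :: "'k::field kronecker_rep"
  assumes M: "shift_form M w S" and N: "shift_form N w' S'"
  shows "subrep N M \<longleftrightarrow> (\<exists>\<Psi> :: nat \<Rightarrow> nat \<Rightarrow> 'k. inj_coeffs w w' \<Psi> \<and> equivariant w S S' \<Psi>)"
proof -
  from M obtain \<tau> where wM: "dimW M = w" and S: "S \<subseteq> {p. Suc p < w}"
    and \<tau>: "bij_betw \<tau> {..<dimV M} S" and f: "mapf M = selection_mat w (dimV M) \<tau>"
    and g: "mapg M = selection_mat w (dimV M) (\<lambda>x. Suc (\<tau> x))"
    unfolding shift_form_def by blast
  from N obtain \<tau>' where wN: "dimW N = w'" and S': "S' \<subseteq> {p. Suc p < w'}"
    and \<tau>': "bij_betw \<tau>' {..<dimV N} S'" and f': "mapf N = selection_mat w' (dimV N) \<tau>'"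
    and g': "mapg N = selection_mat w' (dimV N) (\<lambda>x. Suc (\<tau>' x))"
    unfolding shift_form_def by blast
  have inj: "inj_on \<tau> {..<dimV M}" "inj_on (\<lambda>x. Suc (\<tau> x)) {..<dimV M}"
    and inj': "inj_on \<tau>' {..<dimV N}" "inj_on (\<lambda>x. Suc (\<tau>' x)) {..<dimV N}"
    using \<tau> \<tau>' by (auto simp: bij_betw_def inj_on_def)
  have img: "\<tau> ` {..<dimV M} = S" "(\<lambda>x. Suc (\<tau> x)) ` {..<dimV M} = Suc ` S"
    and img': "\<tau>' ` {..<dimV N} = S'"
    using \<tau> \<tau>' by (auto simp: bij_betw_def)
  have lt: "Suc (\<tau> x) < w" if "x < dimV M" for x using S img(1) that by blast
  have lt': "Suc (\<tau>' x) < w'" if "x < dimV N" for x using S' img' that by blast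
  have rep: "is_kronecker_rep M" "is_kronecker_rep N"
    using wM wN by (simp_all add: is_kronecker_rep_def f g f' g')
  show ?thesis
  proof
    assume "subrep N M"
    then obtain \<phi> \<psi> where \<phi>: "\<phi> \<in> carrier_mat (dimV M) (dimV N)"
      and \<psi>: "\<psi> \<in> carrier_mat w w'" and inj\<psi>: "inj_on (\<lambda>x. \<psi> *\<^sub>v x) (carrier_vec w')"
      and ef: "mapf M * \<phi> = \<psi> * mapf N" and eg: "mapg M * \<phi> = \<psi> * mapg N"
      unfolding subrep_def wM wN by blast
    have 1: "inj_coeffs w w' (\<lambda>q p. \<psi> $$ (q, p))"
      using inj_on_mult_mat_vec_iff[OF \<psi>] inj\<psi> by simp
    have "equivariant w S S' (\<lambda>q p. \<psi> $$ (q, p))"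
      unfolding equivariant_def
    proof (intro ballI allI impI)
      fix p q assume "p \<in> S'" and q: "q < w"
      then obtain y where y: "y < dimV N" and p: "p = \<tau>' y" using img' by auto
      have F: "(mapf M * \<phi>) $$ (r, y) = \<psi> $$ (r, p)" if "r < w" for r
        unfolding ef f' p using mult_selection_mat[OF \<psi> that y] lt'[OF y] by simp
      have G: "(mapg M * \<phi>) $$ (r, y) = \<psi> $$ (r, Suc p)" if "r < w" for r
        unfolding eg g' p using mult_selection_mat[OF \<psi> that y, of "\<lambda>x. Suc (\<tau>' x)"] lt'[OF y] by simp
      have "\<psi> $$ (Suc q, Suc p) = \<psi> $$ (q, p)" if qS: "q \<in> S"
      proof -
        obtain x where x: "x < dimV M" and qx: "q = \<tau> x" using qS img by auto
        have "\<psi> $$ (q, p) = \<phi> $$ (x, y)"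
          using F[of q] selection_mat_mult_hit[OF \<phi> _ y x inj(1), of w] lt[OF x] unfolding f qx by simp
        moreover have "\<psi> $$ (Suc q, Suc p) = \<phi> $$ (x, y)"
          using G[of "Suc q"] selection_mat_mult_hit[OF \<phi> _ y x inj(2), of w] lt[OF x]
          unfolding g qx by simp
        ultimately show ?thesis by simp
      qed
      moreover have "\<psi> $$ (q, p) = 0" if "q \<notin> S"
        using F[OF q] selection_mat_mult_miss[OF \<phi> q y, of \<tau>] img that unfolding f by simp
      moreover have "\<psi> $$ (q, Suc p) = 0" if "q \<notin> Suc ` S"
        using G[OF q] selection_mat_mult_miss[OF \<phi> q y, of "\<lambda>x. Suc (\<tau> x)"] img that unfolding g by simp
      ultimately show "(q \<in> S \<longrightarrow> \<psi> $$ (Suc q, Suc p) = \<psi> $$ (q, p)) \<and>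
        (q \<notin> S \<longrightarrow> \<psi> $$ (q, p) = 0) \<and> (q \<notin> Suc ` S \<longrightarrow> \<psi> $$ (q, Suc p) = 0)" by blast
    qed
    with 1 show "\<exists>\<Psi> :: nat \<Rightarrow> nat \<Rightarrow> 'k. inj_coeffs w w' \<Psi> \<and> equivariant w S S' \<Psi>"
      by (intro exI[of _ "\<lambda>q p. \<psi> $$ (q, p)"] conjI)
  next
    assume "\<exists>\<Psi> :: nat \<Rightarrow> nat \<Rightarrow> 'k. inj_coeffs w w' \<Psi> \<and> equivariant w S S' \<Psi>"
    then obtain \<Psi> :: "nat \<Rightarrow> nat \<Rightarrow> 'k" where \<Psi>: "inj_coeffs w w' \<Psi>" "equivariant w S S' \<Psi>" by blast
    define \<psi> where "\<psi> = mat w w' (\<lambda>(q, p). \<Psi> q p)"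
    define \<phi> where "\<phi> = mat (dimV M) (dimV N) (\<lambda>(x, y). \<Psi> (\<tau> x) (\<tau>' y))"
    have \<psi>: "\<psi> \<in> carrier_mat w w'" and \<phi>: "\<phi> \<in> carrier_mat (dimV M) (dimV N)"
      by (simp_all add: \<psi>_def \<phi>_def)
    have "inj_coeffs w w' (\<lambda>q p. \<psi> $$ (q, p))"
      using \<Psi>(1) by (simp add: inj_coeffs_def \<psi>_def)
    then have inj\<psi>: "inj_on (\<lambda>x. \<psi> *\<^sub>v x) (carrier_vec w')"
      using inj_on_mult_mat_vec_iff[OF \<psi>] by simp
    have ef: "mapf M * \<phi> = \<psi> * mapf N"
    proof (rule eq_matI)
      fix q y assume "q < dim_row (\<psi> * mapf N)" "y < dim_col (\<psi> * mapf N)"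
      then have q: "q < w" and y: "y < dimV N" by (simp_all add: \<psi>_def f' selection_mat_def)
      have p: "\<tau>' y \<in> S'" using img' y by auto
      have R: "(\<psi> * mapf N) $$ (q, y) = \<Psi> q (\<tau>' y)"
        using mult_selection_mat[OF \<psi> q y] lt'[OF y] q by (simp add: f' \<psi>_def)
      show "(mapf M * \<phi>) $$ (q, y) = (\<psi> * mapf N) $$ (q, y)"
      proof (cases "q \<in> S")
        case True
        then obtain x where x: "x < dimV M" "q = \<tau> x" using img by auto
        then show ?thesis unfolding R
          using selection_mat_mult_hit[OF \<phi> _ y x(1) inj(1), of w] q y by (simp add: f \<phi>_def)
      next
        case False
        then show ?thesis unfolding R
          using selection_mat_mult_miss[OF \<phi> q y, of \<tau>] img \<Psi>(2) p q by (auto simp: f equivariant_def)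
      qed
    qed (auto simp: \<psi>_def \<phi>_def f f' selection_mat_def)
    have eg: "mapg M * \<phi> = \<psi> * mapg N"
    proof (rule eq_matI)
      fix q y assume "q < dim_row (\<psi> * mapg N)" "y < dim_col (\<psi> * mapg N)"
      then have q: "q < w" and y: "y < dimV N" by (simp_all add: \<psi>_def g' selection_mat_def)
      have p: "\<tau>' y \<in> S'" using img' y by auto
      have R: "(\<psi> * mapg N) $$ (q, y) = \<Psi> q (Suc (\<tau>' y))"
        using mult_selection_mat[OF \<psi> q y, of "\<lambda>x. Suc (\<tau>' x)"] lt'[OF y] q by (simp add: g' \<psi>_def)
      show "(mapg M * \<phi>) $$ (q, y) = (\<psi> * mapg N) $$ (q, y)"
      proof (cases "q \<in> Suc ` S")
        case True
        then obtain x where x: "x < dimV M" "q = Suc (\<tau> x)" using img by auto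
        then have "\<tau> x \<in> S" using img by auto
        then have "\<Psi> q (Suc (\<tau>' y)) = \<Psi> (\<tau> x) (\<tau>' y)"
          using \<Psi>(2) p q x(2) by (simp add: equivariant_def)
        then show ?thesis unfolding R
          using selection_mat_mult_hit[OF \<phi> _ y x(1) inj(2), of w] q y x by (simp add: g \<phi>_def)
      next
        case False
        then show ?thesis unfolding R
          using selection_mat_mult_miss[OF \<phi> q y, of "\<lambda>x. Suc (\<tau> x)"] img \<Psi>(2) p q
          by (auto simp: g equivariant_def)
      qed
    qed (auto simp: \<psi>_def \<phi>_def g g' selection_mat_def)
    \<comment> \<open>From \<open>f \<phi> = \<psi> f'\<close>, the injectivity of \<open>\<phi>\<close> follows from that of \<open>\<psi>\<close> and of \<open>f'\<close>.\<close>
    have "inj_coeffs w' (dimV N) (\<lambda>q p. mapf N $$ (q, p))"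
      unfolding inj_coeffs_def
    proof (intro allI impI)
      fix c :: "nat \<Rightarrow> 'k" and y
      assume c: "\<forall>q<w'. (\<Sum>p<dimV N. mapf N $$ (q, p) * c p) = 0" and y: "y < dimV N"
      have "(\<Sum>p<dimV N. mapf N $$ (\<tau>' y, p) * c p) = (\<Sum>p<dimV N. if p = y then c p else 0)"
        using lt'[OF y] y inj'(1) by (intro sum.cong) (auto simp: f' selection_mat_def inj_on_def)
      then show "c y = 0" using c lt'[OF y] y by simp
    qed
    then have injf: "inj_on (\<lambda>x. mapf N *\<^sub>v x) (carrier_vec (dimV N))"
      using inj_on_mult_mat_vec_iff[of "mapf N" w' "dimV N"] by (simp add: f')
    have "inj_on (\<lambda>x. \<phi> *\<^sub>v x) (carrier_vec (dimV N))"
    proof (rule inj_onI)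
      fix x y assume x: "x \<in> carrier_vec (dimV N)" and y: "y \<in> carrier_vec (dimV N)"
        and "\<phi> *\<^sub>v x = \<phi> *\<^sub>v y"
      then have eq: "mapf M *\<^sub>v (\<phi> *\<^sub>v x) = mapf M *\<^sub>v (\<phi> *\<^sub>v y)" by simp
      have fM: "mapf M \<in> carrier_mat w (dimV M)" and fN: "mapf N \<in> carrier_mat w' (dimV N)"
        by (simp_all add: f f')
      have "\<psi> *\<^sub>v (mapf N *\<^sub>v z) = mapf M *\<^sub>v (\<phi> *\<^sub>v z)" if "z \<in> carrier_vec (dimV N)" for z
        using that assoc_mult_mat_vec[OF fM \<phi> that] assoc_mult_mat_vec[OF \<psi> fN that] ef by simp
      then have "\<psi> *\<^sub>v (mapf N *\<^sub>v x) = \<psi> *\<^sub>v (mapf N *\<^sub>v y)" using x y eq by simp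
      then have "mapf N *\<^sub>v x = mapf N *\<^sub>v y"
        by (rule inj_onD[OF inj\<psi>]) (use fN x y in auto)
      then show "x = y" by (rule inj_onD[OF injf]) (use x y in auto)
    qed
    then show "subrep N M"
      unfolding subrep_def wM wN using rep \<phi> \<psi> inj\<psi> ef eg by blast
  qed
qed

section \<open>The line of positions of a preprojective representation\<close>

text \<open>
  The summand \<open>Q (a (Suc i))\<close> occupies the block of positions from \<open>offset a i\<close> to
  \<open>offset a (Suc i) - 1\<close>; blocks are counted from \<open>0\<close> although the sequence starts with \<open>a 1\<close>.
\<close>

definition offset :: "(nat \<Rightarrow> nat) \<Rightarrow> nat \<Rightarrow> nat" where
  "offset a i = (\<Sum>j = 1..i. a j)"

lemma offset_0 [simp]: "offset a 0 = 0"
  by (simp add: offset_def)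

lemma offset_Suc [simp]: "offset a (Suc i) = offset a i + a (Suc i)"
  by (simp add: offset_def)

lemma offset_mono: "i \<le> j \<Longrightarrow> offset a i \<le> offset a j"
  by (rule lift_Suc_mono_le[of "offset a"]) simp_all

definition inner_positions :: "(nat \<Rightarrow> nat) \<Rightarrow> nat \<Rightarrow> nat set" where
  "inner_positions a m = {p. p < offset a m \<and> Suc p \<notin> offset a ` {..m}}"

lemma inner_positions_Suc:
  assumes "1 \<le> a (Suc m)"
  shows "inner_positions a (Suc m) =
    inner_positions a m \<union> {offset a m ..< offset a m + (a (Suc m) - 1)}"
proof (rule Set.set_eqI)
  fix p
  show "p \<in> inner_positions a (Suc m) \<longleftrightarrow>
    p \<in> inner_positions a m \<union> {offset a m ..< offset a m + (a (Suc m) - 1)}"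
  proof (cases "p < offset a m")
    case True
    then show ?thesis using assms by (auto simp: inner_positions_def atMost_Suc)
  next
    case False
    then have "Suc p \<notin> offset a ` {..m}" using offset_mono[of _ m a] by fastforce
    then show ?thesis using False assms by (auto simp: inner_positions_def atMost_Suc)
  qed
qed

lemma preprojective_Suc:
  fixes M :: "'k::field kronecker_rep" and a :: "nat \<Rightarrow> nat" and m :: nat
  defines "M \<equiv> preprojective m a"
  shows "dimV (preprojective (Suc m) a :: 'k kronecker_rep) = dimV M + (a (Suc m) - 1)"
    and "dimW (preprojective (Suc m) a :: 'k kronecker_rep) = dimW M + a (Suc m)"
    and "mapf (preprojective (Suc m) a :: 'k kronecker_rep) =
      four_block_mat (mapf M) (0\<^sub>m (dim_row (mapf M)) (dim_col (mapf (Q (a (Suc m)) :: 'k kronecker_rep))))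
        (0\<^sub>m (dim_row (mapf (Q (a (Suc m)) :: 'k kronecker_rep))) (dim_col (mapf M))) (mapf (Q (a (Suc m))))"
    and "mapg (preprojective (Suc m) a :: 'k kronecker_rep) =
      four_block_mat (mapg M) (0\<^sub>m (dim_row (mapg M)) (dim_col (mapg (Q (a (Suc m)) :: 'k kronecker_rep))))
        (0\<^sub>m (dim_row (mapg (Q (a (Suc m)) :: 'k kronecker_rep))) (dim_col (mapg M))) (mapg (Q (a (Suc m))))"
  unfolding M_def preprojective_def direct_sum_rep_def
  by (simp_all add: diag_block_mat_last Let_def) (simp_all add: Q_def)

lemma mapf_Q: "1 \<le> i \<Longrightarrow> mapf (Q i) = selection_mat i (i - 1) (\<lambda>x. x)"
  by (rule eq_matI) (auto simp: Q_def selection_mat_def append_rows_def)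

lemma mapg_Q: "1 \<le> i \<Longrightarrow> mapg (Q i) = selection_mat i (i - 1) Suc"
  by (rule eq_matI) (auto simp: Q_def selection_mat_def append_rows_def)

lemma four_block_selection_mat:
  assumes "\<And>x. x < v \<Longrightarrow> \<sigma> x < w"
  shows "four_block_mat (selection_mat w v \<sigma>) (0\<^sub>m w v') (0\<^sub>m w' v) (selection_mat w' v' \<sigma>') =
    selection_mat (w + w') (v + v') (\<lambda>x. if x < v then \<sigma> x else w + \<sigma>' (x - v))"
  using assms by (intro eq_matI) (fastforce simp: selection_mat_def)+

lemma shift_form_preprojective:
  assumes "\<And>i. 1 \<le> i \<Longrightarrow> i \<le> m \<Longrightarrow> 1 \<le> a i"
  shows "shift_form (preprojective m a :: 'k::field kronecker_rep) (offset a m) (inner_positions a m)"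
  using assms
proof (induction m)
  case 0
  have "selection_mat 0 0 \<sigma> = (0\<^sub>m 0 0 :: 'k mat)" for \<sigma>
    by (auto simp: selection_mat_def)
  then show ?case
    by (auto simp: shift_form_def inner_positions_def preprojective_def direct_sum_rep_def bij_betw_def)
next
  case (Suc m)
  define M :: "'k kronecker_rep" where "M = preprojective m a"
  define M' :: "'k kronecker_rep" where "M' = preprojective (Suc m) a"
  define b where "b = a (Suc m)"
  define w where "w = offset a m"
  have b: "1 \<le> b" using Suc.prems by (simp add: b_def)
  have "shift_form M w (inner_positions a m)" using Suc unfolding M_def w_def by simp
  then obtain \<tau> where wM: "dimW M = w" and S: "inner_positions a m \<subseteq> {p. Suc p < w}"
    and \<tau>: "bij_betw \<tau> {..<dimV M} (inner_positions a m)" and f: "mapf M = selection_mat w (dimV M) \<tau>"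
    and g: "mapg M = selection_mat w (dimV M) (\<lambda>x. Suc (\<tau> x))"
    unfolding shift_form_def by blast
  have lt: "Suc (\<tau> x) < w" if "x < dimV M" for x using S \<tau> that by (auto simp: bij_betw_def)
  define \<tau>' where "\<tau>' = (\<lambda>x. if x < dimV M then \<tau> x else w + (x - dimV M))"
  have dV: "dimV M' = dimV M + (b - 1)" and dW: "dimW M' = w + b"
    using preprojective_Suc(1,2)[where 'k='k, of m a] wM by (simp_all add: M_def M'_def b_def)
  have f': "mapf M' = selection_mat (w + b) (dimV M') \<tau>'"
    using four_block_selection_mat[where 'a='k, of "dimV M" \<tau> w "b - 1" b "\<lambda>x. x"] lt
    unfolding M'_def preprojective_Suc(3) mapf_Q[OF b[unfolded b_def]]
    unfolding M_def[symmetric] M'_def[symmetric] b_def[symmetric] f dV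
    by (simp add: \<tau>'_def selection_mat_def Suc_lessD)
  have Suc_\<tau>': "(\<lambda>x. Suc (\<tau>' x)) = (\<lambda>x. if x < dimV M then Suc (\<tau> x) else w + Suc (x - dimV M))"
    by (auto simp: \<tau>'_def)
  have g': "mapg M' = selection_mat (w + b) (dimV M') (\<lambda>x. Suc (\<tau>' x))"
    using four_block_selection_mat[where 'a='k, of "dimV M" "\<lambda>x. Suc (\<tau> x)" w "b - 1" b Suc] lt
    unfolding M'_def preprojective_Suc(4) mapg_Q[OF b[unfolded b_def]]
    unfolding M_def[symmetric] M'_def[symmetric] b_def[symmetric] g dV Suc_\<tau>'
    by (simp add: selection_mat_def)
  have S'_eq: "inner_positions a (Suc m) = inner_positions a m \<union> {w ..< w + (b - 1)}"
    using inner_positions_Suc[of a m] b by (simp add: b_def w_def)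
  have img: "\<tau>' ` {..<dimV M'} = inner_positions a (Suc m)"
  proof -
    have "{..<dimV M'} = {..<dimV M} \<union> {dimV M..<dimV M + (b - 1)}" using dV by auto
    moreover have "\<tau>' ` {..<dimV M} = inner_positions a m" using \<tau> by (auto simp: bij_betw_def \<tau>'_def)
    moreover have "\<tau>' ` {dimV M..<dimV M + (b - 1)} = {w..<w + (b - 1)}"
    proof (intro equalityI subsetI)
      fix p assume "p \<in> {w..<w + (b - 1)}"
      then show "p \<in> \<tau>' ` {dimV M..<dimV M + (b - 1)}"
        by (intro image_eqI[of _ _ "dimV M + (p - w)"]) (auto simp: \<tau>'_def)
    qed (auto simp: \<tau>'_def)
    ultimately show ?thesis using S'_eq by (simp add: image_Un)
  qed
  have "inj_on \<tau>' {..<dimV M'}"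
  proof (rule inj_onI)
    fix x y assume "\<tau>' x = \<tau>' y"
    then show "x = y"
      using bij_betw_imp_inj_on[OF \<tau>] lt[of x] lt[of y]
      by (cases "x < dimV M"; cases "y < dimV M") (simp_all add: \<tau>'_def inj_on_eq_iff)
  qed
  with img have "bij_betw \<tau>' {..<dimV M'} (inner_positions a (Suc m))" by (simp add: bij_betw_def)
  moreover have "inner_positions a (Suc m) \<subseteq> {p. Suc p < w + b}" using S S'_eq by auto
  moreover have "offset a (Suc m) = w + b" by (simp add: w_def b_def)
  ultimately show ?case
    using f' g' dW unfolding shift_form_def M'_def[symmetric] by auto
qed

lemma position_block:
  assumes "p < offset a m"
  obtains i l where "i < m" "l < a (Suc i)" "p = offset a i + l"
proof -
  have "\<exists>i<m. \<exists>l<a (Suc i). p = offset a i + l"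
    using assms
  proof (induction m)
    case (Suc m)
    show ?case
    proof (cases "p < offset a m")
      case True
      then show ?thesis using Suc.IH less_SucI by blast
    next
      case False
      then show ?thesis using Suc.prems by (intro exI[of _ m] conjI exI[of _ "p - offset a m"]) auto
    qed
  qed simp
  then show thesis using that by blast
qed

lemma offset_le_if_less: "i < i' \<Longrightarrow> offset a i + a (Suc i) \<le> offset a i'"
  using offset_mono[of "Suc i" i' a] by simp

lemma block_index_unique:
  assumes "offset a i + l = offset a i' + l'" "l < a (Suc i)" "l' < a (Suc i')"
  shows "i = i' \<and> l = l'"
proof -
  have "i = i'"
    using offset_le_if_less[of i i' a] offset_le_if_less[of i' i a] assms by (cases i i' rule: linorder_cases) auto
  then show ?thesis using assms by simp
qed

lemma inner_positions_iff:
  assumes "i < m" "l < a (Suc i)"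
  shows "offset a i + l \<in> inner_positions a m \<longleftrightarrow> Suc l < a (Suc i)"
proof
  assume "offset a i + l \<in> inner_positions a m"
  moreover have "offset a (Suc i) \<in> offset a ` {..m}" using assms by (intro imageI) simp
  ultimately have "Suc (offset a i + l) \<noteq> offset a (Suc i)" unfolding inner_positions_def by fastforce
  then show "Suc l < a (Suc i)" using assms by simp
next
  assume l: "Suc l < a (Suc i)"
  have "Suc (offset a i + l) \<noteq> offset a x" for x
    using offset_mono[of x i a] offset_le_if_less[of i x a] l by (cases "x \<le> i") auto
  then show "offset a i + l \<in> inner_positions a m"
    using assms offset_le_if_less[of i m a] by (auto simp: inner_positions_def)
qed

lemma offset_notin_Suc_inner: "i \<le> m \<Longrightarrow> offset a i \<notin> Suc ` inner_positions a m"
  unfolding inner_positions_def by force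

section \<open>Necessity of the inequalities\<close>

text \<open>
  There is no nonzero morphism from \<open>Q d\<close> to \<open>Q a\<close> if \<open>d > a\<close>. Every diagonal of the block ends in a
  zero: above the main diagonal one walks back to the first row, which is reached in a column other
  than the first; otherwise one walks on to the last row, which is reached before the last column
  because the block has more columns than rows.
\<close>

lemma equivariant_block_eq_0:
  assumes eq: "equivariant (offset a m) (inner_positions a m) (inner_positions d n) \<Psi>"
    and i: "i < m" and j: "j < n" and less: "a (Suc i) < d (Suc j)"
    and l: "l < a (Suc i)" and k: "k < d (Suc j)"
  shows "\<Psi> (offset a i + l) (offset d j + k) = 0"
proof -
  let ?S = "inner_positions a m" and ?S' = "inner_positions d n"
  have q: "offset a i + x < offset a m" if "x < a (Suc i)" for x
    using offset_le_if_less[OF i, of a] that by simp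
  show ?thesis
  proof (cases "l < k")
    case True
    then show ?thesis using l k
    proof (induction l arbitrary: k)
      case 0
      then obtain k' where k': "k = Suc k'" using gr0_implies_Suc by blast
      then have "offset d j + k' \<in> ?S'" using inner_positions_iff[OF j, of k' d] 0 by simp
      then have "\<Psi> (offset a i) (Suc (offset d j + k')) = 0"
        using eq q[of 0] 0 offset_notin_Suc_inner[of i m a] i by (simp add: equivariant_def)
      then show ?case using k' by simp
    next
      case (Suc l)
      then obtain k' where k': "k = Suc k'" using gr0_implies_Suc by fastforce
      have "offset d j + k' \<in> ?S'" using inner_positions_iff[OF j, of k' d] Suc.prems k' by simp
      moreover have "offset a i + l \<in> ?S" using inner_positions_iff[OF i, of l a] Suc.prems by simp
      ultimately have "\<Psi> (Suc (offset a i + l)) (Suc (offset d j + k')) = \<Psi> (offset a i + l) (offset d j + k')"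
        using eq q[of l] Suc.prems by (simp add: equivariant_def)
      then show ?case using Suc.IH[of k'] Suc.prems k' by simp
    qed
  next
    case False
    then have "k \<le> l" by simp
    then show ?thesis using l
    proof (induction "a (Suc i) - l" arbitrary: k l rule: less_induct)
      case less: less
      have "offset d j + k \<in> ?S'"
        using inner_positions_iff[OF j, of k d] less.prems \<open>a (Suc i) < d (Suc j)\<close> by simp
      then have "(offset a i + l \<in> ?S \<longrightarrow>
            \<Psi> (Suc (offset a i + l)) (Suc (offset d j + k)) = \<Psi> (offset a i + l) (offset d j + k)) \<and>
          (offset a i + l \<notin> ?S \<longrightarrow> \<Psi> (offset a i + l) (offset d j + k) = 0)"
        using eq q[of l] less.prems by (simp add: equivariant_def)
      moreover have "\<Psi> (Suc (offset a i + l)) (Suc (offset d j + k)) = 0" if "Suc l < a (Suc i)"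
        using less.hyps[of "Suc l" "Suc k"] less.prems that by simp
      ultimately show ?case using less.prems inner_positions_iff[OF i, of l a] by metis
    qed
  qed
qed

text \<open>
  The dimension count, in the form in which it is applied: the first \<open>x\<close> columns are supported in
  the first \<open>y\<close> rows. If \<open>y < x\<close>, then the \<open>x \<times> x\<close> matrix of these entries, filled up with zero rows,
  is singular, and a vector in its kernel contradicts injectivity.
\<close>

lemma inj_coeffs_dim_le:
  fixes \<Psi> :: "nat \<Rightarrow> nat \<Rightarrow> 'k::field"
  assumes inj: "inj_coeffs w w' \<Psi>" and x: "x \<le> w'"
    and zero: "\<And>q p. y \<le> q \<Longrightarrow> q < w \<Longrightarrow> p < x \<Longrightarrow> \<Psi> q p = 0"
  shows "x \<le> y"
proof (rule ccontr)
  assume "\<not> x \<le> y"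
  then have y: "y < x" by simp
  define B where "B = mat x x (\<lambda>(q, p). if q < y then \<Psi> q p else 0)"
  have B: "B \<in> carrier_mat x x" by (simp add: B_def)
  have "transpose_mat B *\<^sub>v unit_vec x y = 0\<^sub>v x"
    using y by (intro eq_vecI) (auto simp: B_def)
  moreover have "unit_vec x y \<noteq> (0\<^sub>v x :: 'k vec)"
    using y by (metis index_unit_vec(2) index_zero_vec(1) zero_neq_one)
  ultimately have "\<exists>v. v \<in> carrier_vec x \<and> v \<noteq> 0\<^sub>v x \<and> transpose_mat B *\<^sub>v v = 0\<^sub>v x"
    by (intro exI[of _ "unit_vec x y"]) simp
  then have "det (transpose_mat B) = 0"
    using det_0_iff_vec_prod_zero_field[of "transpose_mat B" x] B by simp
  then have "det B = 0" using det_transpose[OF B] by simp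
  then obtain v where v: "v \<in> carrier_vec x" "v \<noteq> 0\<^sub>v x" "B *\<^sub>v v = 0\<^sub>v x"
    using det_0_iff_vec_prod_zero_field[OF B] by auto
  define c where "c = (\<lambda>p. if p < x then v $ p else 0)"
  have "(\<Sum>p<w'. \<Psi> q p * c p) = 0" if q: "q < w" for q
  proof -
    have "(\<Sum>p<w'. \<Psi> q p * c p) = (\<Sum>p<x. \<Psi> q p * v $ p)"
      using x by (intro sum.mono_neutral_cong_right) (auto simp: c_def)
    also have "\<dots> = 0"
    proof (cases "q < y")
      case True
      then have "(\<Sum>p<x. \<Psi> q p * v $ p) = (B *\<^sub>v v) $ q"
        using y by (subst mult_mat_vec_coeff[OF B v(1)]) (auto simp: B_def)
      then show ?thesis using True y v(3) by simp
    next
      case False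
      then show ?thesis using zero q by (intro sum.neutral) auto
    qed
    finally show ?thesis .
  qed
  then have "c p = 0" if "p < x" for p using inj x that by (simp add: inj_coeffs_def)
  then have "v = 0\<^sub>v x" using v(1) by (intro eq_vecI) (auto simp: c_def)
  with v(2) show False by simp
qed

text \<open>
  The summands \<open>d 1, \<dots>, d r\<close> are all longer than \<open>a (s + 1), a (s + 2), \<dots>\<close>, so an embedding maps them
  into the sum of the first \<open>s\<close> summands.
\<close>

lemma embedding_offset_le:
  fixes \<Psi> :: "nat \<Rightarrow> nat \<Rightarrow> 'k::field"
  assumes inj: "inj_coeffs (offset a m) (offset d n) \<Psi>"
    and eq: "equivariant (offset a m) (inner_positions a m) (inner_positions d n) \<Psi>"
    and a_decr: "\<And>i j. 1 \<le> i \<Longrightarrow> i \<le> j \<Longrightarrow> j \<le> m \<Longrightarrow> a i \<ge> a j"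
    and d_decr: "\<And>i j. 1 \<le> i \<Longrightarrow> i \<le> j \<Longrightarrow> j \<le> n \<Longrightarrow> d i \<ge> d j"
    and r: "1 \<le> r" "r \<le> n" and less: "ext0 m a (s + 1) < d r"
  shows "offset d r \<le> offset a s"
proof (rule inj_coeffs_dim_le[OF inj])
  show "offset d r \<le> offset d n" using r by (simp add: offset_mono)
  fix q p assume q: "offset a s \<le> q" "q < offset a m" and p: "p < offset d r"
  obtain i l where i: "i < m" "l < a (Suc i)" "q = offset a i + l" using position_block[OF q(2)] .
  obtain j k where j: "j < r" "k < d (Suc j)" "p = offset d j + k" using position_block[OF p] .
  have "s \<le> i" using offset_le_if_less[of i s a] q i by (cases "s \<le> i") auto
  then have "a (Suc i) \<le> a (Suc s)" using a_decr[of "Suc s" "Suc i"] i by simp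
  also have "\<dots> < d r" using less \<open>s \<le> i\<close> i by (simp add: ext0_def)
  also have "\<dots> \<le> d (Suc j)" using d_decr[of "Suc j" r] j r by simp
  finally show "\<Psi> q p = 0"
    using equivariant_block_eq_0[OF eq i(1) _ _ i(2) j(2)] i j r by simp
qed

lemma offset_minus_1:
  assumes "\<And>i. 1 \<le> i \<Longrightarrow> i \<le> m \<Longrightarrow> 1 \<le> a i" "i \<le> m"
  shows "offset (\<lambda>j. a j - 1) i + i = offset a i"
  using assms(2)
proof (induction i)
  case (Suc i)
  then show ?case using assms(1)[of "Suc i"] by simp
qed simp

text \<open>
  The inequalities for the dimensions of \<open>V\<close> are a numerical consequence of those for \<open>W\<close>. When
  \<open>s \<le> r\<close>, one subtracts \<open>r\<close> on the left and only \<open>s\<close> on the right. When \<open>r < s\<close>, it suffices to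
  compare the first \<open>r\<close> summands on both sides, which is the induction \<open>diag\<close>: a step with
  \<open>d x \<le> a x\<close> keeps the inequality, and at a step with \<open>a x < d x\<close> the bound applies with \<open>s = x - 1\<close>.
\<close>

lemma offset_minus_1_le:
  assumes a_pos: "\<And>i. 1 \<le> i \<Longrightarrow> i \<le> m \<Longrightarrow> 1 \<le> a i"
    and d_pos: "\<And>i. 1 \<le> i \<Longrightarrow> i \<le> n \<Longrightarrow> 1 \<le> d i"
    and bound: "\<And>r s. 1 \<le> r \<Longrightarrow> r \<le> n \<Longrightarrow> s \<le> m \<Longrightarrow> ext0 m a (s + 1) < d r \<Longrightarrow> offset d r \<le> offset a s"
    and r: "1 \<le> r" "r \<le> n" and s: "s \<le> m" and less: "ext0 m a (s + 1) < d r"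
  shows "offset (\<lambda>j. d j - 1) r \<le> offset (\<lambda>j. a j - 1) s"
proof -
  note red = offset_minus_1[of m a, OF a_pos] offset_minus_1[of n d, OF d_pos]
  have diag: "offset (\<lambda>j. d j - 1) x \<le> offset (\<lambda>j. a j - 1) x" if "x \<le> n" "x \<le> m" for x
    using that
  proof (induction x)
    case (Suc x)
    show ?case
    proof (cases "d (Suc x) \<le> a (Suc x)")
      case True
      then show ?thesis using Suc by (simp add: add_mono diff_le_mono)
    next
      case False
      then have "offset d (Suc x) \<le> offset a x"
        using bound[of "Suc x" x] Suc.prems by (simp add: ext0_def)
      then have "offset (\<lambda>j. d j - 1) (Suc x) \<le> offset (\<lambda>j. a j - 1) x"
        using red(1)[of x] red(2)[of "Suc x"] Suc.prems by simp
      then show ?thesis by simp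
    qed
  qed simp
  show ?thesis
  proof (cases "s \<le> r")
    case True
    then show ?thesis using bound[OF r s less] red(1)[of s] red(2)[of r] r s by simp
  next
    case False
    then show ?thesis
      using diag[of r] offset_mono[of r s "\<lambda>j. a j - 1"] r s by simp
  qed
qed

section \<open>The embedding built from two subdivisions of a line\<close>

text \<open>
  The blocks of both representations are laid out on the same line, starting at \<open>0\<close>. The map to be
  constructed connects block \<open>j\<close> of the source with block \<open>i\<close> of the target exactly if they overlap.
\<close>

definition overlap :: "(nat \<Rightarrow> nat) \<Rightarrow> (nat \<Rightarrow> nat) \<Rightarrow> nat \<Rightarrow> nat \<Rightarrow> bool" where
  "overlap a d i j \<longleftrightarrow> offset d j < offset a (Suc i) \<and> offset a i < offset d (Suc j)"

text \<open>
  The exponent of the monomial by which block \<open>j\<close> is mapped into block \<open>i\<close>. It is the relative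
  position of block \<open>j\<close>, moved into the range \<open>0, \<dots>, a (Suc i) - d (Suc j)\<close> of admissible exponents. A
  block inside block \<open>i\<close> stays in place; one that crosses the left boundary is pushed to the start of
  block \<open>i\<close> (natural subtraction gives \<open>0\<close>), and one that crosses the right boundary is pushed to
  its end.
\<close>

definition block_shift :: "(nat \<Rightarrow> nat) \<Rightarrow> (nat \<Rightarrow> nat) \<Rightarrow> nat \<Rightarrow> nat \<Rightarrow> nat" where
  "block_shift a d i j = min (offset d j - offset a i) (a (Suc i) - d (Suc j))"

definition target :: "nat \<Rightarrow> nat \<Rightarrow> (nat \<Rightarrow> nat) \<Rightarrow> (nat \<Rightarrow> nat) \<Rightarrow> nat \<Rightarrow> nat \<Rightarrow> bool" where
  "target m n a d q p \<longleftrightarrow> (\<exists>i<m. \<exists>j<n. overlap a d i j \<and>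
     (\<exists>k<d (Suc j). p = offset d j + k \<and> q = offset a i + block_shift a d i j + k))"

text \<open>
  Under the assumption \<open>fit\<close> a source block meets at most two target blocks, since a target block
  strictly between its ends would be shorter than it.
\<close>

context
  fixes m n :: nat and a d :: "nat \<Rightarrow> nat"
  assumes fit: "\<And>i j. i < m \<Longrightarrow> j < n \<Longrightarrow> overlap a d i j \<Longrightarrow> d (Suc j) \<le> a (Suc i)"
begin

lemma target_iff_column:
  assumes "j < n" "k < d (Suc j)"
  shows "target m n a d q (offset d j + k) \<longleftrightarrow>
    (\<exists>i<m. overlap a d i j \<and> q = offset a i + block_shift a d i j + k)"
proof
  assume "target m n a d q (offset d j + k)"
  then obtain i j' k' where *: "i < m" "overlap a d i j'" "k' < d (Suc j')"
    "offset d j + k = offset d j' + k'" "q = offset a i + block_shift a d i j' + k'"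
    unfolding target_def by blast
  then have "j = j' \<and> k = k'" using block_index_unique assms by metis
  then show "\<exists>i<m. overlap a d i j \<and> q = offset a i + block_shift a d i j + k" using * by auto
qed (use assms in \<open>auto simp: target_def\<close>)

lemma block_shift_less:
  assumes "i < m" "j < n" "overlap a d i j" "k < d (Suc j)"
  shows "block_shift a d i j + k < a (Suc i)"
  using fit[OF assms(1-3)] assms(4) by (auto simp: block_shift_def)

lemma target_rowD:
  assumes "target m n a d (offset a i + l) p" "l < a (Suc i)"
  obtains j k where "j < n" "overlap a d i j" "k < d (Suc j)" "p = offset d j + k"
    "l = block_shift a d i j + k"
proof -
  from assms(1) obtain i' j k where *: "i' < m" "j < n" "overlap a d i' j" "k < d (Suc j)"
    "p = offset d j + k" "offset a i + l = offset a i' + block_shift a d i' j + k"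
    unfolding target_def by blast
  then have "i = i' \<and> l = block_shift a d i' j + k"
    using block_index_unique[of a i l i' "block_shift a d i' j + k"] assms(2) block_shift_less[OF *(1-4)]
    by (simp add: add.assoc)
  then show thesis using that * by auto
qed

lemma equivariant_target:
  "equivariant (offset a m) (inner_positions a m) (inner_positions d n)
     (\<lambda>q p. if target m n a d q p then 1 else (0 :: 'k::field))"
  unfolding equivariant_def
proof (intro ballI allI impI)
  fix p q assume p: "p \<in> inner_positions d n" and q: "q < offset a m"
  then have "p < offset d n" by (simp add: inner_positions_def)
  then obtain j k where j: "j < n" "k < d (Suc j)" and pjk: "p = offset d j + k"
    by (rule position_block)
  have k: "Suc k < d (Suc j)" using p inner_positions_iff[of j n k d] j pjk by simp
  have "target m n a d (Suc q) (Suc p) \<longleftrightarrow> target m n a d q p"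
    using target_iff_column[OF j, of q] target_iff_column[OF j(1) k, of "Suc q"] by (simp add: pjk)
  moreover have inner: "offset a i + (block_shift a d i j + k) \<in> inner_positions a m"
    if "i < m" "overlap a d i j" for i
    using block_shift_less[OF that(1) j(1) that(2) k] inner_positions_iff[of i m _ a] that by simp
  have "q \<in> inner_positions a m" if "target m n a d q p"
    using that inner target_iff_column[OF j, of q] by (auto simp: pjk add.assoc)
  moreover have "q \<in> Suc ` inner_positions a m" if "target m n a d q (Suc p)"
    using that inner target_iff_column[OF j(1) k, of q] by (auto simp: pjk add.assoc)
  ultimately show "(q \<in> inner_positions a m \<longrightarrow>
      (if target m n a d (Suc q) (Suc p) then 1 else (0::'k)) = (if target m n a d q p then 1 else 0)) \<and>
    (q \<notin> inner_positions a m \<longrightarrow> (if target m n a d q p then 1 else (0::'k)) = 0) \<and>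
    (q \<notin> Suc ` inner_positions a m \<longrightarrow> (if target m n a d q (Suc p) then 1 else (0::'k)) = 0)"
    by auto
qed

text \<open>
  Let \<open>c\<close> be in the kernel. A source block inside a target block stays in place. A source block \<open>j\<close> that
  crosses the boundary \<open>b\<close> of two target blocks, with the part of length \<open>\<delta> = offset d (Suc j) - b\<close> to
  the right of \<open>b\<close>, is copied to the end of the left target block and to the start of the right one.
  Its positions with \<open>k \<ge> \<delta>\<close> in the left copy, and those with \<open>k < \<delta>\<close> in the right copy, land inside
  the source block itself; these entries form a permutation of all positions of the source line. The
  other entries of the matrix only disturb in one direction: those of a column with \<open>k \<ge> \<delta>\<close> lie to
  the right of the source block, and those of a column with \<open>k < \<delta>\<close> to the left of it. So the
  equations are solved in two passes. The first goes from left to right and shows that \<open>c\<close> vanishes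
  at the positions with \<open>k \<ge> \<delta>\<close>. The second goes from right to left and treats all other positions.
\<close>

lemma inj_coeffs_target:
  assumes total: "offset d n \<le> offset a m"
  shows "inj_coeffs (offset a m) (offset d n) (\<lambda>q p. if target m n a d q p then 1 else (0 :: 'k::field))"
  unfolding inj_coeffs_def
proof (intro allI impI)
  fix c :: "nat \<Rightarrow> 'k" and p
  assume ker: "\<forall>q<offset a m. (\<Sum>p<offset d n. (if target m n a d q p then 1 else 0) * c p) = 0"
  \<comment> \<open>The equation of row \<open>offset a i + l\<close>, when all its other unknowns are already known to vanish.\<close>
  have pivot: "c p = 0"
    if i: "i < m" and j: "j < n" and ov: "overlap a d i j" and k: "k < d (Suc j)"
      and p: "p = offset d j + k" and l: "l = block_shift a d i j + k"
      and others: "\<And>j' k'. j' < n \<Longrightarrow> j' \<noteq> j \<Longrightarrow> overlap a d i j' \<Longrightarrow> k' < d (Suc j') \<Longrightarrow>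
        l = block_shift a d i j' + k' \<Longrightarrow> c (offset d j' + k') = 0"
    for i j k p l
  proof -
    define q where "q = offset a i + l"
    have la: "l < a (Suc i)" using block_shift_less[OF i j ov k] l by simp
    have q: "q < offset a m" using offset_le_if_less[OF i, of a] la by (simp add: q_def)
    have pn: "p < offset d n" using offset_le_if_less[OF j, of d] k p by simp
    have tp: "target m n a d q p"
      unfolding target_def q_def l p using i j ov k by (auto simp: add.assoc)
    have "c p' = 0" if ne: "p' \<noteq> p" and tgt: "target m n a d q p'" for p'
    proof -
      obtain j' k' where *: "j' < n" "overlap a d i j'" "k' < d (Suc j')" "p' = offset d j' + k'"
        "l = block_shift a d i j' + k'"
        using target_rowD[OF tgt[unfolded q_def] la] .
      then have "j' \<noteq> j" using ne l p by auto
      then show ?thesis using others * by simp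
    qed
    then have "(\<Sum>p'<offset d n. (if target m n a d q p' then 1 else 0) * c p') =
        (\<Sum>p'<offset d n. if p' = p then c p' else 0)"
      using tp by (intro sum.cong) auto
    then show "c p = 0" using ker q pn by simp
  qed
  \<comment> \<open>First pass: the positions \<open>k \<ge> \<delta>\<close> of a block that crosses a boundary, read in the left copy.\<close>
  have early: "c p = 0"
    if "i < m" "j < n" "offset d j < offset a (Suc i)" "offset a (Suc i) < offset d (Suc j)"
      "k < d (Suc j)" "offset d (Suc j) \<le> offset a (Suc i) + k" "p = offset d j + k"
    for i j k p
    using that
  proof (induction p arbitrary: i j k rule: less_induct)
    case (less p)
    note prems = less.prems
    have ov: "overlap a d i j" using prems by (simp add: overlap_def)
    have le: "d (Suc j) \<le> a (Suc i)" using fit[OF prems(1,2) ov] .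
    have sh: "block_shift a d i j = a (Suc i) - d (Suc j)"
      using le prems by (simp add: block_shift_def)
    show ?case
    proof (rule pivot[OF prems(1,2) ov prems(5,7) refl])
      fix j' k' assume j': "j' < n" "j' \<noteq> j" and ov': "overlap a d i j'" and k': "k' < d (Suc j')"
        and eq: "block_shift a d i j + k = block_shift a d i j' + k'"
      have "\<not> j < j'"
        using ov' offset_le_if_less[of j j' d] prems by (auto simp: overlap_def)
      then have "offset d (Suc j') \<le> offset d j" using j' by (intro offset_mono) simp
      moreover have "offset d j \<le> offset a i + (block_shift a d i j + k)"
        using sh le prems by simp
      ultimately have far: "offset d (Suc j') \<le> offset a i + (block_shift a d i j' + k')"
        using eq by simp
      \<comment> \<open>The row under consideration lies beyond block \<open>j'\<close>. So \<open>j'\<close> is not left in place, hence it crosses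
        the left boundary of block \<open>i\<close>, and \<open>k'\<close> is one of its positions treated by this pass.\<close>
      show "c (offset d j' + k') = 0"
      proof (cases "offset a i \<le> offset d j'")
        case True
        then have "offset a i + block_shift a d i j' \<le> offset d j'" by (simp add: block_shift_def)
        then show ?thesis using far k' by simp
      next
        case False
        then obtain i0 where i0: "i = Suc i0" by (cases i) auto
        have "block_shift a d i j' = 0" using False by (simp add: block_shift_def)
        then show ?thesis
          using less.IH[of "offset d j' + k'" i0 j' k'] False far ov' k' j' prems i0
            \<open>offset d (Suc j') \<le> offset d j\<close>
          by (simp add: overlap_def)
      qed
    qed
  qed
  \<comment> \<open>Second pass, from the last position down.\<close>
  have all: "c p = 0" if "p < offset d n" for p
    using that
  proof (induction "offset d n - p" arbitrary: p rule: less_induct)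
    case less
    obtain j k where j: "j < n" and k: "k < d (Suc j)" and p: "p = offset d j + k"
      using position_block[OF less.prems] .
    have later: "c (offset d j' + k') = 0" if "j < j'" "j' < n" "k' < d (Suc j')" for j' k'
      using less.hyps[of "offset d j' + k'"] that less.prems k
        offset_le_if_less[of j j' d] offset_le_if_less[of j' n d] p by simp
    have "offset d j < offset a m" using total less.prems p by simp
    then obtain i l where i: "i < m" "l < a (Suc i)" "offset d j = offset a i + l" by (rule position_block)
    consider (inside) "offset d (Suc j) \<le> offset a (Suc i)"
      | (left) "offset a (Suc i) < offset d (Suc j)" "offset d (Suc j) \<le> offset a (Suc i) + k"
      | (right) "offset a (Suc i) + k < offset d (Suc j)"
      by linarith
    then show "c p = 0"
    proof cases
      case inside
      \<comment> \<open>Earlier blocks contribute to this row only through entries covered by the first pass.\<close>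
      have ov: "overlap a d i j" using i k by (simp add: overlap_def)
      have sh: "block_shift a d i j = offset d j - offset a i"
        using inside i by (simp add: block_shift_def)
      show ?thesis
      proof (rule pivot[OF i(1) j ov k p refl])
        fix j' k' assume j': "j' < n" "j' \<noteq> j" and ov': "overlap a d i j'" and k': "k' < d (Suc j')"
          and eq: "block_shift a d i j + k = block_shift a d i j' + k'"
        show "c (offset d j' + k') = 0"
        proof (cases "j < j'")
          case True
          then show ?thesis using later j' k' by simp
        next
          case False
          then have "offset d (Suc j') \<le> offset d j" using j' by (intro offset_mono) simp
          then have far: "offset d (Suc j') \<le> offset a i + (block_shift a d i j' + k')"
            using eq sh i by simp
          show ?thesis
          proof (cases "offset a i \<le> offset d j'")
            case True
            then have "offset a i + block_shift a d i j' \<le> offset d j'" by (simp add: block_shift_def)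
            then show ?thesis using far k' by simp
          next
            case False
            then obtain i0 where i0: "i = Suc i0" by (cases i) auto
            have "block_shift a d i j' = 0" using False by (simp add: block_shift_def)
            then show ?thesis
              using early[of i0 j' k'] False far ov' k' j' i i0 by (simp add: overlap_def)
          qed
        qed
      qed
    next
      case left
      then show ?thesis using early[of i j k p] i j k p by simp
    next
      case right
      \<comment> \<open>Here the right copy is used; no earlier block reaches into block \<open>Suc i\<close>.\<close>
      have i': "Suc i < m"
      proof (rule ccontr)
        assume "\<not> Suc i < m"
        then have "m = Suc i" using i(1) by simp
        then show False using right total offset_mono[of "Suc j" n d] j by simp
      qed
      have ov: "overlap a d (Suc i) j" using i right by (simp add: overlap_def)
      have "block_shift a d (Suc i) j = 0" using i by (simp add: block_shift_def)
      then have l: "k = block_shift a d (Suc i) j + k" by simp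
      show ?thesis
      proof (rule pivot[OF i' j ov k p l])
        fix j' k' assume j': "j' < n" "j' \<noteq> j" and ov': "overlap a d (Suc i) j'" and k': "k' < d (Suc j')"
        have "\<not> j' < j"
          using ov' offset_le_if_less[of j' j d] i by (auto simp: overlap_def)
        then show "c (offset d j' + k') = 0" using later j' k' by simp
      qed
    qed
  qed
  assume "p < offset d n"
  then show "c p = 0" by (rule all)
qed

end

section \<open>The integers of the process and the embedding criterion\<close>

lemma max0_in: "finite A \<Longrightarrow> max0 A \<noteq> 0 \<Longrightarrow> max0 A \<in> A"
  by (auto simp: max0_def split: if_splits)

lemma r_next_le: "r_next m n a d s \<le> n"
  unfolding r_next_def by (rule max0_le) auto

lemma r_next_witness:
  "r_next m n a d s \<noteq> 0 \<Longrightarrow> ext0 m a (s + 1) < d (r_next m n a d s)"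
  unfolding r_next_def by (drule max0_in[rotated]) auto

lemma s_num_le: "s_num m n a d l \<le> m"
  by (cases l) (auto simp: s_next_def intro!: max0_le)

lemma r_num_Suc: "r_num m n a d (l + 1) = r_next m n a d (s_num m n a d l)"
  by (simp add: r_num_def)

lemma s_num_witness:
  assumes "1 \<le> l" "s_num m n a d l \<noteq> 0"
  shows "d (r_num m n a d l + 1) \<le> a (s_num m n a d l)"
proof -
  obtain k where l: "l = Suc k" using assms(1) by (cases l) auto
  let ?r = "r_num m n a d l"
  let ?A = "{i. 1 \<le> i \<and> i \<le> m \<and> d (?r + 1) \<le> a i}"
  have "s_num m n a d l = s_next m n a d ?r" by (simp add: l r_num_def)
  then have "s_num m n a d l = max0 ?A" using assms(2) by (simp add: s_next_def split: if_splits)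
  moreover have "max0 ?A \<in> ?A" by (rule max0_in) (use assms(2) calculation in auto)
  ultimately show ?thesis by simp
qed

text \<open>
  The inequalities at the ends of the process intervals \<open>r l < j \<le> r (l + 1)\<close> give one for every
  \<open>j\<close>: if \<open>l\<close> is the index of the interval that contains \<open>j\<close>, then \<open>s = s l\<close> works, since
  \<open>d j \<le> d (r l + 1) \<le> a s\<close>. Geometrically, block \<open>j\<close> ends before the target blocks become too short
  for it.
\<close>

lemma partial_sums_cover:
  assumes d_pos: "\<And>i. 1 \<le> i \<Longrightarrow> i \<le> n \<Longrightarrow> d i \<ge> 1"
    and a_decr: "\<And>i j. 1 \<le> i \<Longrightarrow> i \<le> j \<Longrightarrow> j \<le> m \<Longrightarrow> a i \<ge> a j"
    and d_decr: "\<And>i j. 1 \<le> i \<Longrightarrow> i \<le> j \<Longrightarrow> j \<le> n \<Longrightarrow> d i \<ge> d j"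
    and r1: "r_num m n a d 1 = 0"
    and sums: "\<And>i. 1 \<le> i \<Longrightarrow> i \<le> t_num m n a d - 1 \<Longrightarrow>
      offset d (r_num m n a d (i + 1)) \<le> offset a (s_num m n a d i)"
    and j: "1 \<le> j" "j \<le> n"
  obtains s where "s \<le> m" "offset d j \<le> offset a s" "\<And>i. 1 \<le> i \<Longrightarrow> i \<le> s \<Longrightarrow> d j \<le> a i"
proof -
  let ?P = "\<lambda>l. 1 \<le> l \<and> j \<le> r_num m n a d l"
  have t: "?P (t_num m n a d)" using t_num_stops[of n d m a] d_pos j by simp
  define l' where "l' = (LEAST l. ?P l)"
  have l': "?P l'" "l' \<le> t_num m n a d"
    unfolding l'_def using t by (auto intro: LeastI2 Least_le)
  moreover have "l' \<noteq> 1" using l' r1 j by auto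
  ultimately obtain l where l: "l' = l + 1" "1 \<le> l" by (cases l') auto
  have "\<not> ?P l" using not_less_Least[of l ?P] l unfolding l'_def by simp
  then have rl: "r_num m n a d l < j" using l by simp
  let ?s = "s_num m n a d l"
  show thesis
  proof (rule that[of ?s])
    show "?s \<le> m" by (rule s_num_le)
    have "offset d j \<le> offset d (r_num m n a d (l + 1))" using l' l by (intro offset_mono) simp
    also have "\<dots> \<le> offset a ?s" using sums[of l] l l' by simp
    finally show "offset d j \<le> offset a ?s" .
    fix i assume i: "1 \<le> i" "i \<le> ?s"
    have "d j \<le> d (r_num m n a d l + 1)" using d_decr rl j by simp
    also have "\<dots> \<le> a ?s" using s_num_witness[OF l(2), of m n a d] i by simp
    also have "\<dots> \<le> a i" using a_decr i s_num_le[of m n a d l] by simp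
    finally show "d j \<le> a i" .
  qed
qed

theorem theorem6:
  fixes m n :: nat and a d :: "nat \<Rightarrow> nat"
  assumes a_pos: "\<And>i. 1 \<le> i \<Longrightarrow> i \<le> m \<Longrightarrow> a i \<ge> 1"
    and a_decr: "\<And>i j. 1 \<le> i \<Longrightarrow> i \<le> j \<Longrightarrow> j \<le> m \<Longrightarrow> a i \<ge> a j"
    and d_pos: "\<And>i. 1 \<le> i \<Longrightarrow> i \<le> n \<Longrightarrow> d i \<ge> 1"
    and d_decr: "\<And>i j. 1 \<le> i \<Longrightarrow> i \<le> j \<Longrightarrow> j \<le> n \<Longrightarrow> d i \<ge> d j"
  shows "subrep (preprojective n d) (preprojective m a :: 'k::alg_closed_field kronecker_rep) \<longleftrightarrow>
    r_num m n a d 1 = 0 \<and>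
    (\<forall>i. 1 \<le> i \<and> i \<le> t_num m n a d - 1 \<longrightarrow>
       (\<Sum>j = 1..s_num m n a d i. a j)
         \<ge> (\<Sum>j = r_num m n a d 1 + 1..r_num m n a d (i + 1). d j) \<and>
       (\<Sum>j = 1..s_num m n a d i. (a j - 1))
         \<ge> (\<Sum>j = r_num m n a d 1 + 1..r_num m n a d (i + 1). (d j - 1)))"
    (is "?sub \<longleftrightarrow> ?r1 \<and> ?sums")
proof -
  have iff: "?sub \<longleftrightarrow> (\<exists>\<Psi> :: nat \<Rightarrow> nat \<Rightarrow> 'k. inj_coeffs (offset a m) (offset d n) \<Psi> \<and>
      equivariant (offset a m) (inner_positions a m) (inner_positions d n) \<Psi>)"
    by (intro subrep_iff_equivariant shift_form_preprojective a_pos d_pos)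
  show ?thesis
  proof
    assume ?sub
    then obtain \<Psi> :: "nat \<Rightarrow> nat \<Rightarrow> 'k" where inj: "inj_coeffs (offset a m) (offset d n) \<Psi>"
      and eq: "equivariant (offset a m) (inner_positions a m) (inner_positions d n) \<Psi>"
      using iff by blast
    have bound: "offset d r \<le> offset a s" if "1 \<le> r" "r \<le> n" "ext0 m a (s + 1) < d r" for r s
      using embedding_offset_le[OF inj eq a_decr d_decr that] by blast
    have r1: ?r1
    proof (rule ccontr)
      let ?r = "r_num m n a d 1"
      assume "?r \<noteq> 0"
      then have r: "1 \<le> ?r" "?r \<le> n" "ext0 m a (0 + 1) < d ?r"
        using r_next_le[of m n a d 0] r_next_witness[of m n a d 0] by (auto simp: r_num_def)
      have "d 1 \<le> offset d ?r" using offset_mono[of 1 ?r d] r by simp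
      moreover have "offset d ?r \<le> 0" using bound[OF r] by simp
      ultimately show False using d_pos[of 1] r by simp
    qed
    have ?sums
    proof (intro allI impI)
      fix i
      let ?r = "r_num m n a d (i + 1)" and ?s = "s_num m n a d i"
      have "offset d ?r \<le> offset a ?s \<and> offset (\<lambda>j. d j - 1) ?r \<le> offset (\<lambda>j. a j - 1) ?s"
      proof (cases "?r = 0")
        case False
        then have r: "1 \<le> ?r" "?r \<le> n" "ext0 m a (?s + 1) < d ?r"
          unfolding r_num_Suc using r_next_le r_next_witness by (simp_all add: Suc_leI)
        show ?thesis
          using bound[OF r] offset_minus_1_le[OF a_pos d_pos bound r(1,2) s_num_le r(3)] by simp
      qed simp
      then show "(\<Sum>j = 1..?s. a j) \<ge> (\<Sum>j = r_num m n a d 1 + 1..?r. d j) \<and>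
          (\<Sum>j = 1..?s. (a j - 1)) \<ge> (\<Sum>j = r_num m n a d 1 + 1..?r. (d j - 1))"
        unfolding r1 offset_def by simp
    qed
    with r1 show "?r1 \<and> ?sums" by blast
  next
    assume R: "?r1 \<and> ?sums"
    have sums: "offset d (r_num m n a d (i + 1)) \<le> offset a (s_num m n a d i)"
      if "1 \<le> i" "i \<le> t_num m n a d - 1" for i
      using conjunct1[OF R] conjunct2[OF R] that by (simp add: offset_def)
    note cover = partial_sums_cover[OF d_pos a_decr d_decr conjunct1[OF R] sums]
    have fit: "d (Suc j) \<le> a (Suc i)" if i: "i < m" and j: "j < n" and ov: "overlap a d i j" for i j
    proof -
      obtain s where s: "s \<le> m" "offset d (Suc j) \<le> offset a s"
        "\<And>i. 1 \<le> i \<Longrightarrow> i \<le> s \<Longrightarrow> d (Suc j) \<le> a i"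
        using cover[of "Suc j"] j by auto
      have "i < s"
        using ov s(2) offset_mono[of s i a] by (cases "i < s") (auto simp: overlap_def)
      then show ?thesis using s(3)[of "Suc i"] by simp
    qed
    have total: "offset d n \<le> offset a m"
    proof (cases "n = 0")
      case False
      then obtain s where "s \<le> m" "offset d n \<le> offset a s" using cover[of n] by auto
      then show ?thesis using offset_mono[of s m a] by simp
    qed simp
    show ?sub
      unfolding iff using inj_coeffs_target[of m n a d, OF fit total] equivariant_target[of m n a d, OF fit]
      by blast
  qed
qed

end
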